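(* Let $R$ be a graded ring supported in non-negative degrees, let $M$ be a Gröbner-coherent graded $R$-module, let $N$ be a finitely generated, not necessarily homogeneous, submodule of $M$, and let $x_1,\ldots,x_n$ be a set of nonzero generators for $N$. Then Buchberger's algorithm applied to $x_1,\ldots,x_n$ terminates after finitely many steps and yields a Gröbner basis for $N$.
   Context: Rings are commutative with unit; gradings are by $\mathbb{Z}$; graded modules $M$ are assumed to satisfy $M_n=0$ for $n\ll 0$. For a nonzero $x=\sum_n x_n\in M$ with $x_n\in M_n$, $\deg(x)$ is the maximal $n$ with $x_n\ne 0$ and $\mathrm{in}(x)=x_{\deg(x)}$; degrees of elements of $R$ are defined likewise; set $\deg(0)=-\infty$, $\mathrm{in}(0)=0$. For a (not necessarily homogeneous) submodule $N\subset M$, $\mathrm{in}(N)$ is the homogeneous submodule generated by $\mathrm{in}(x)$ over all nonzero $x\in N$. A Gröbner basis for $N$ is a collection of elements of $N$ whose initial terms generate $\mathrm{in}(N)$ as an $R$-module. For a collection $\{x_i\}$ of elements of $N$ and $y\in N$, an expression $y=\sum_ia_ix_i$ with $a_i\in R$ (finitely many nonzero) is reduced if $\deg(a_i)+\deg(x_i)\le\deg(y)$ for all $i$. A graded module is graded-coherent if it is finitely generated and every finitely generated homogeneous submodule is finitely presented. A graded module $M$ is Gröbner-coherent if it is graded-coherent and every finitely generated, not necessarily homogeneous, submodule of $M$ admits a finite Gröbner basis. Buchberger's algorithm: the input is a generating set $X=\{x_i\}_{i\in I}$ of $N$ consisting of nonzero elements. (a) Choose a homogeneous generating set $\sum_{i}c_{i,j}e_i$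 ($j\in J$) of the module of syzygies of the $\mathrm{in}(x_i)$, i.e. of the kernel of $\bigoplus_{i\in I}Re_i\to M$, $e_i\mapsto\mathrm{in}(x_i)$, where $e_i$ has degree $\deg(x_i)$ (so each $c_{i,j}$ is homogeneous and, whenever $c_{i,j}\neq 0$, $\deg(c_{i,j})+\deg(x_i)$ is independent of $i$), and compute $Z=\{z_j\}_{j\in J}$ with $z_j=\sum_{i}c_{i,j}x_i$. (When $X$ is finite and $M$ is graded-coherent, $J$ can be and is taken finite.) (b) If each $z_j$ has a reduced expression in terms of the elements of $X$, output $X$ and terminate. (c) Otherwise, replace $X$ with $X\cup Z$ (discarding any zero elements of $Z$) and return to (a). The number of steps is the number of times the replacement in (c) is performed. *)

theory Defs
  imports Complex_Main "HOL-Library.Extended" "HOL-Library.Function_Algebras"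
begin

section \<open>Gradings by the integers\<close>

definition decomposes :: "(int \<Rightarrow> 'a::ab_group_add set) \<Rightarrow> 'a \<Rightarrow> (int \<Rightarrow> 'a) \<Rightarrow> bool" where
  "decomposes A x f \<longleftrightarrow>
     (\<forall>n. f n \<in> A n) \<and> finite {n. f n \<noteq> 0} \<and> x = (\<Sum>n | f n \<noteq> 0. f n)"

text \<open>The additive group is the internal direct sum of the subgroups \<open>A n\<close>.\<close>

locale grading =
  fixes A :: "int \<Rightarrow> 'a::ab_group_add set"
  assumes zero_closed: "0 \<in> A n"
    and add_closed: "x \<in> A n \<Longrightarrow> y \<in> A n \<Longrightarrow> x + y \<in> A n"
    and uminus_closed: "x \<in> A n \<Longrightarrow> - x \<in> A n"
    and decomposes_ex1: "\<exists>!f. decomposes A x f"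

definition component :: "(int \<Rightarrow> 'a::ab_group_add set) \<Rightarrow> 'a \<Rightarrow> int \<Rightarrow> 'a" where
  "component A x = (THE f. decomposes A x f)"

definition top_deg :: "(int \<Rightarrow> 'a::ab_group_add set) \<Rightarrow> 'a \<Rightarrow> int" where
  "top_deg A x = Max {n. component A x n \<noteq> 0}"

text \<open>\<open>Minf\<close> is the value minus infinity; it is absorbing in all sums that occur below.\<close>

definition deg :: "(int \<Rightarrow> 'a::ab_group_add set) \<Rightarrow> 'a \<Rightarrow> int extended" where
  "deg A x = (if x = 0 then Minf else Fin (top_deg A x))"

definition initial :: "(int \<Rightarrow> 'a::ab_group_add set) \<Rightarrow> 'a \<Rightarrow> 'a" where
  "initial A x = (if x = 0 then 0 else component A x (top_deg A x))"

definition homogeneous :: "(int \<Rightarrow> 'a set) \<Rightarrow> 'a \<Rightarrow> bool" where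
  "homogeneous A x \<longleftrightarrow> (\<exists>n. x \<in> A n)"


section \<open>Free modules\<close>

text \<open>
  The free module on \<open>I\<close> consists of the finitely supported functions \<open>c :: 'i \<Rightarrow> 'r\<close> that vanish
  outside \<open>I\<close>; \<open>c\<close> stands for the sum of the \<open>c i\<close> times the basis vectors \<open>e\<^sub>i\<close>.  Submodules of it are
  taken with respect to the pointwise scalar multiplication \<open>fun_scale\<close>.
\<close>

definition free_module :: "'i set \<Rightarrow> ('i \<Rightarrow> 'r::zero) set" where
  "free_module I = {c. finite {i. c i \<noteq> 0} \<and> {i. c i \<noteq> 0} \<subseteq> I}"

definition fun_scale :: "'r::comm_ring_1 \<Rightarrow> ('i \<Rightarrow> 'r) \<Rightarrow> ('i \<Rightarrow> 'r)" where
  "fun_scale r c = (\<lambda>i. r * c i)"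

lemma module_fun_scale: "module fun_scale"
  by unfold_locales (simp_all add: fun_scale_def fun_eq_iff algebra_simps)


section \<open>Graded modules\<close>

text \<open>\<open>A\<close> grades the ring (the whole type \<open>'r\<close>) and \<open>B\<close> the module (the whole type \<open>'m\<close>).\<close>

locale graded_module = module scale + ring_grading: grading A + module_grading: grading B
  for scale :: "'r::comm_ring_1 \<Rightarrow> 'm::ab_group_add \<Rightarrow> 'm" (infixr \<open>*s\<close> 75)
    and A :: "int \<Rightarrow> 'r set"
    and B :: "int \<Rightarrow> 'm set" +
  assumes mult_graded: "a \<in> A i \<Longrightarrow> b \<in> A j \<Longrightarrow> a * b \<in> A (i + j)"
    and scale_graded: "a \<in> A i \<Longrightarrow> x \<in> B j \<Longrightarrow> a *s x \<in> B (i + j)"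
    and bounded_below: "\<exists>n0. \<forall>n<n0. B n = {0}"
begin

definition lincomb :: "('i \<Rightarrow> 'r) \<Rightarrow> ('i \<Rightarrow> 'm) \<Rightarrow> 'm" where
  "lincomb c g = (\<Sum>i | c i \<noteq> 0. c i *s g i)"

definition syzygies :: "'i set \<Rightarrow> ('i \<Rightarrow> 'm) \<Rightarrow> ('i \<Rightarrow> 'r) set" where
  "syzygies I g = {c \<in> free_module I. lincomb c g = 0}"

definition finitely_generated :: "'m set \<Rightarrow> bool" where
  "finitely_generated N \<longleftrightarrow> (\<exists>F. finite F \<and> span F = N)"

definition finitely_presented :: "'m set \<Rightarrow> bool" where
  "finitely_presented N \<longleftrightarrow>
     (\<exists>(k::nat) (g :: nat \<Rightarrow> 'm). span (g ` {..<k}) = N \<and>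
        (\<exists>K. finite K \<and> module.span fun_scale K = syzygies {..<k} g))"

definition homogeneous_submodule :: "'m set \<Rightarrow> bool" where
  "homogeneous_submodule N \<longleftrightarrow> subspace N \<and> (\<forall>x\<in>N. \<forall>n. component B x n \<in> N)"

definition graded_coherent :: bool where
  "graded_coherent \<longleftrightarrow> finitely_generated UNIV \<and>
     (\<forall>N. homogeneous_submodule N \<longrightarrow> finitely_generated N \<longrightarrow> finitely_presented N)"

definition initial_submodule :: "'m set \<Rightarrow> 'm set" where
  "initial_submodule N = span (initial B ` (N - {0}))"

definition groebner_basis :: "'m set \<Rightarrow> 'm set \<Rightarrow> bool" where
  "groebner_basis G N \<longleftrightarrow> G \<subseteq> N \<and> span (initial B ` G) = initial_submodule N"

definition groebner_coherent :: bool where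
  "groebner_coherent \<longleftrightarrow> graded_coherent \<and>
     (\<forall>N. subspace N \<longrightarrow> finitely_generated N \<longrightarrow> (\<exists>G. finite G \<and> groebner_basis G N))"


subsection \<open>Buchberger's algorithm\<close>

text \<open>
  A collection \<open>X\<close> of module elements is a set, indexed by itself: a coefficient family for \<open>X\<close> is a
  function on \<open>'m\<close> supported in \<open>X\<close>.
\<close>

definition has_reduced_expression :: "'m set \<Rightarrow> 'm \<Rightarrow> bool" where
  "has_reduced_expression X y \<longleftrightarrow>
     (\<exists>a \<in> free_module X. y = lincomb a (\<lambda>x. x) \<and>
        (\<forall>x\<in>X. deg A (a x) + deg B x \<le> deg B y))"

text \<open>Homogeneity in the free module on \<open>X\<close> in which the basis vector \<open>e\<^sub>x\<close> has degree \<open>deg B x\<close>.\<close>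

definition homogeneous_coeffs :: "('m \<Rightarrow> 'r) \<Rightarrow> bool" where
  "homogeneous_coeffs c \<longleftrightarrow>
     (\<forall>x. homogeneous A (c x)) \<and> (\<exists>d. \<forall>x. c x \<noteq> 0 \<longrightarrow> deg A (c x) + deg B x = d)"

text \<open>
  The data chosen in step (a), for finite \<open>X\<close>: a finite set \<open>C\<close> of homogeneous generators of the
  module of syzygies of the initial terms.
\<close>

definition syzygy_choice :: "'m set \<Rightarrow> ('m \<Rightarrow> 'r) set \<Rightarrow> bool" where
  "syzygy_choice X C \<longleftrightarrow> finite C \<and> (\<forall>c\<in>C. homogeneous_coeffs c) \<and>
     module.span fun_scale C = syzygies X (initial B)"

definition lifts :: "('m \<Rightarrow> 'r) set \<Rightarrow> 'm set" where
  "lifts C = (\<lambda>c. lincomb c (\<lambda>x. x)) ` C"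

definition buchberger_stop :: "'m set \<Rightarrow> bool" where
  "buchberger_stop X \<longleftrightarrow>
     (\<exists>C. syzygy_choice X C \<and> (\<forall>z\<in>lifts C. has_reduced_expression X z))"

definition buchberger_step :: "'m set \<Rightarrow> 'm set \<Rightarrow> bool" where
  "buchberger_step X X' \<longleftrightarrow>
     (\<exists>C. syzygy_choice X C \<and> \<not> (\<forall>z\<in>lifts C. has_reduced_expression X z) \<and>
          X' = X \<union> (lifts C - {0}))"

text \<open>
  The algorithm is nondeterministic because of the choice in step (a), so its runs are the chains of
  the relation \<open>buchberger_step\<close>.  Termination means that no run is infinite and that no run
  gets stuck, i.e. that the choice in step (a) is possible at every stage that is reached.
\<close>

definition buchberger_terminates :: "'m set \<Rightarrow> bool" where
  "buchberger_terminates X \<longleftrightarrow>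
     \<not> (\<exists>Y :: nat \<Rightarrow> 'm set. Y 0 = X \<and> (\<forall>k. buchberger_step (Y k) (Y (Suc k)))) \<and>
     (\<forall>Y. buchberger_step\<^sup>*\<^sup>* X Y \<longrightarrow> (\<exists>C. syzygy_choice Y C))"

definition buchberger_output :: "'m set \<Rightarrow> 'm set \<Rightarrow> bool" where
  "buchberger_output X G \<longleftrightarrow> buchberger_step\<^sup>*\<^sup>* X G \<and> buchberger_stop G"

end

end

theory Submission
  imports Defs
begin

text \<open>
  Measure an expression of an element of \<open>N\<close> by the largest degree of its terms.  If this exceeds the
  degree of the element, then the leading coefficients form a syzygy of the initial terms, so
  once the lifted syzygies are available as generators (or have reduced expressions) the element has
  an expression of strictly smaller degree.  This gives correctness: when the algorithm stops, every
  element has a reduced expression.  It also gives termination: after finitely many steps each member of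
  some finite Groebner basis of \<open>N\<close> has a reduced expression, hence the current generators form a
  Groebner basis, and by division all lifted syzygies have reduced expressions.  The choice in step (a)
  is possible because finite generation of syzygies does not depend on the generators, and homogeneous
  components of syzygies of homogeneous elements are again syzygies.
\<close>

section \<open>Components in a graded group\<close>

text \<open>A subgroup rather than an inequality of degrees: \<open>0\<close> needs no separate
  case, and cancellation of leading terms becomes the vanishing of one component.\<close>

definition deg_le :: "(int \<Rightarrow> 'a::ab_group_add set) \<Rightarrow> int \<Rightarrow> 'a set" where
  "deg_le A d = {x. \<forall>n>d. component A x n = 0}"

context grading
begin

lemma decomposes_component: "decomposes A x (component A x)"
  unfolding component_def using theI'[OF decomposes_ex1] .

lemma component_closed: "component A x n \<in> A n"
  using decomposes_component by (auto simp: decomposes_def)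

lemma finite_component: "finite {n. component A x n \<noteq> 0}"
  using decomposes_component by (auto simp: decomposes_def)

lemma sum_component: "(\<Sum>n | component A x n \<noteq> 0. component A x n) = x"
  using decomposes_component[of x] by (simp add: decomposes_def)

lemma component_eqI:
  assumes "\<And>n. f n \<in> A n" "finite S" "\<And>n. n \<notin> S \<Longrightarrow> f n = 0" "x = sum f S"
  shows "component A x = f"
proof -
  have sub: "{n. f n \<noteq> 0} \<subseteq> S" using assms(3) by auto
  have "sum f S = sum f {n. f n \<noteq> 0}"
    by (rule sum.mono_neutral_right) (use sub assms in auto)
  then have "decomposes A x f"
    using assms sub by (auto simp: decomposes_def intro: finite_subset)
  then show ?thesis
    using decomposes_ex1 decomposes_component by blast
qed

lemma sum_component_superset:
  assumes "finite S" "{n. component A x n \<noteq> 0} \<subseteq> S"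
  shows "sum (component A x) S = x"
proof -
  have "sum (component A x) S = sum (component A x) {n. component A x n \<noteq> 0}"
    by (rule sum.mono_neutral_right) (use assms in auto)
  then show ?thesis by (simp add: sum_component)
qed

lemma component_homogeneous: "x \<in> A n \<Longrightarrow> component A x m = (if m = n then x else 0)"
  by (subst component_eqI[where f = "\<lambda>m. if m = n then x else 0" and S = "{n}"])
    (auto intro: zero_closed)

lemma component_zero [simp]: "component A 0 n = 0"
  using component_homogeneous[OF zero_closed] by simp

lemma component_add: "component A (x + y) n = component A x n + component A y n"
proof -
  let ?S = "{n. component A x n \<noteq> 0} \<union> {n. component A y n \<noteq> 0}"
  have "finite ?S" by (simp add: finite_component)
  then have "component A (x + y) = (\<lambda>n. component A x n + component A y n)"
    by (intro component_eqI[where S = ?S])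
      (auto simp: sum.distrib sum_component_superset intro: add_closed component_closed)
  then show ?thesis by simp
qed

lemma component_uminus: "component A (- x) n = - component A x n"
  using component_add[of x "- x" n] by (simp add: eq_neg_iff_add_eq_0 add.commute)

lemma component_diff: "component A (x - y) n = component A x n - component A y n"
  using component_add[of x "- y" n] by (simp add: component_uminus)

lemma component_sum: "component A (sum f S) n = (\<Sum>s\<in>S. component A (f s) n)"
  by (induction S rule: infinite_finite_induct) (auto simp: component_add)

lemma component_top_deg_nonzero:
  assumes "x \<noteq> 0"
  shows "component A x (top_deg A x) \<noteq> 0"
proof -
  have "{n. component A x n \<noteq> 0} \<noteq> {}"
    using sum_component[of x] assms by force
  from Max_in[OF finite_component this] show ?thesis
    by (simp add: top_deg_def)
qed

lemma component_above_top_deg: "n > top_deg A x \<Longrightarrow> component A x n = 0"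
  using Max_ge[OF finite_component, of n x] by (force simp: top_deg_def)

lemma deg_le_iff: "x \<in> deg_le A d \<longleftrightarrow> x = 0 \<or> top_deg A x \<le> d"
proof
  show "x = 0 \<or> top_deg A x \<le> d" if "x \<in> deg_le A d"
    using that component_top_deg_nonzero[of x] by (force simp: deg_le_def not_le[symmetric])
  show "x \<in> deg_le A d" if "x = 0 \<or> top_deg A x \<le> d"
    using that component_above_top_deg[of x] by (auto simp: deg_le_def)
qed

lemma deg_le_top_deg: "x \<in> deg_le A (top_deg A x)"
  by (simp add: deg_le_iff)

lemma deg_le_mono: "x \<in> deg_le A d \<Longrightarrow> d \<le> d' \<Longrightarrow> x \<in> deg_le A d'"
  by (auto simp: deg_le_def)

lemma homogeneous_deg_le: "x \<in> A d \<Longrightarrow> x \<in> deg_le A d"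
  by (auto simp: deg_le_def component_homogeneous)

lemma deg_le_pred: "x \<in> deg_le A d \<Longrightarrow> component A x d = 0 \<Longrightarrow> x \<in> deg_le A (d - 1)"
  unfolding deg_le_def by clarify (case_tac "n = d", auto)

lemma deg_le_zero [simp]: "0 \<in> deg_le A d"
  by (simp add: deg_le_def)

lemma deg_le_add: "x \<in> deg_le A d \<Longrightarrow> y \<in> deg_le A d \<Longrightarrow> x + y \<in> deg_le A d"
  by (simp add: deg_le_def component_add)

lemma deg_le_diff: "x \<in> deg_le A d \<Longrightarrow> y \<in> deg_le A d \<Longrightarrow> x - y \<in> deg_le A d"
  by (simp add: deg_le_def component_diff)

lemma initial_eq: "initial A x = component A x (top_deg A x)"
  by (simp add: initial_def)

lemma initial_closed: "initial A x \<in> A (top_deg A x)"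
  by (simp add: initial_eq component_closed)

lemma top_deg_homogeneous: "x \<in> A n \<Longrightarrow> x \<noteq> 0 \<Longrightarrow> top_deg A x = n"
  using component_top_deg_nonzero[of x] component_homogeneous[of x n "top_deg A x"]
  by (auto split: if_splits)

lemma homogeneous_component: "homogeneous A (component A x n)"
  using component_closed by (auto simp: homogeneous_def)

end

text \<open>An additive map that shifts degrees by \<open>j\<close> carries the decomposition of
  \<open>a\<close> to that of \<open>\<phi> a\<close>. Multiplication by a homogeneous element, in
  the ring or into the module, is of this kind.\<close>

lemma component_additive_shift:
  assumes "grading A" "grading B" "additive \<phi>" "\<And>n a. a \<in> A n \<Longrightarrow> \<phi> a \<in> B (n + j)"
  shows "component B (\<phi> a) n = \<phi> (component A a (n - j))"
proof -
  interpret A: grading A by fact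
  interpret B: grading B by fact
  interpret \<phi>: additive \<phi> by fact
  have "\<phi> a = (\<Sum>m | component A a m \<noteq> 0. \<phi> (component A a m))"
    by (simp add: \<phi>.sum[symmetric] A.sum_component)
  moreover have "component B (\<phi> (component A a m)) n = (if m = n - j then \<phi> (component A a m) else 0)" for m
    using B.component_homogeneous[OF assms(4)[OF A.component_closed]] by auto
  ultimately show ?thesis
    by (auto simp: B.component_sum A.finite_component sum.delta \<phi>.zero)
qed

section \<open>Finite linear combinations\<close>

text \<open>Coefficients are indexed by \<open>X\<close> and not by the image, since different
  generators may share an initial term.\<close>

lemma (in module) in_span_imageD:
  assumes "w \<in> span (f ` X)" "finite X"
  shows "\<exists>a. w = (\<Sum>x\<in>X. scale (a x) (f x))"
  using assms(1)
proof (induction rule: span_induct_alt)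
  case base
  show ?case by (rule exI[of _ "\<lambda>_. 0"]) simp
next
  case (step c y z)
  then obtain x a where "x \<in> X" "y = f x" and a: "z = (\<Sum>x\<in>X. scale (a x) (f x))"
    by auto
  have "scale c y = (\<Sum>x'\<in>X. scale (if x' = x then c else 0) (f x'))"
    using \<open>x \<in> X\<close> \<open>y = f x\<close> \<open>finite X\<close>
    by (simp add: if_distrib[of "\<lambda>t. scale t _"] if_distribR sum.delta cong: if_cong)
  then have "scale c y + z = (\<Sum>x'\<in>X. scale ((if x' = x then c else 0) + a x') (f x'))"
    by (simp add: a sum.distrib scale_left_distrib)
  then show ?case by (intro exI)
qed

lemma (in module) sum_in_span_image: "(\<Sum>x\<in>X. scale (a x) (f x)) \<in> span (f ` X)"
  by (intro span_sum span_scale span_base) auto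

lemma sum_fun_apply: "(\<Sum>s\<in>S. f s) i = (\<Sum>s\<in>S. f s i)"
  by (induction S rule: infinite_finite_induct) (auto simp: zero_fun_def plus_fun_def)

lemma in_free_moduleI: "finite X \<Longrightarrow> (\<And>x. x \<notin> X \<Longrightarrow> a x = 0) \<Longrightarrow> a \<in> free_module X"
  by (auto simp: free_module_def intro: finite_subset)

context graded_module
begin

lemma lincomb_eq_sum:
  assumes "finite X" "a \<in> free_module X"
  shows "lincomb a g = (\<Sum>x\<in>X. a x *s g x)"
  unfolding lincomb_def
  using assms by (intro sum.mono_neutral_left) (auto simp: free_module_def)

lemma in_syzygies_iff:
  assumes "finite X"
  shows "c \<in> syzygies X g \<longleftrightarrow> (\<forall>x. x \<notin> X \<longrightarrow> c x = 0) \<and> (\<Sum>x\<in>X. c x *s g x) = 0"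
proof -
  have "c \<in> free_module X \<longleftrightarrow> (\<forall>x. x \<notin> X \<longrightarrow> c x = 0)"
    using in_free_moduleI[OF assms, of c] by (auto simp: free_module_def)
  then show ?thesis
    using lincomb_eq_sum[OF assms, of c g] by (auto simp: syzygies_def)
qed

section \<open>Components of products\<close>

lemma component_scale_homogeneous_right:
  "x \<in> B j \<Longrightarrow> component B (a *s x) n = component A a (n - j) *s x"
  by (rule component_additive_shift[where \<phi> = "\<lambda>a. a *s x"])
    (unfold_locales, auto simp: scale_left_distrib scale_graded)

lemma component_mult_homogeneous_right:
  "b \<in> A j \<Longrightarrow> component A (a * b) n = component A a (n - j) * b"
  by (rule component_additive_shift[where \<phi> = "\<lambda>a. a * b"])
    (unfold_locales, auto simp: distrib_right mult_graded)

text \<open>Comparing degree \<open>i\<close> components in \<open>1 * a = a\<close> shows that the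
  degree 0 component of 1 fixes every homogeneous \<open>a\<close>. It therefore fixes every
  component of 1, so it equals 1.\<close>

lemma one_in_degree_zero: "1 \<in> A 0"
proof -
  let ?e = "component A 1 0"
  have homog: "?e * a = a" if "a \<in> A i" for a i
    using component_mult_homogeneous_right[OF that, of 1 i]
    by (simp add: ring_grading.component_homogeneous[OF that])
  have "?e * 1 = ?e * (\<Sum>n | component A 1 n \<noteq> 0. component A 1 n)"
    by (simp add: ring_grading.sum_component)
  also have "\<dots> = (\<Sum>n | component A 1 n \<noteq> 0. component A 1 n)"
    unfolding sum_distrib_left
    by (intro sum.cong refl homog[OF ring_grading.component_closed])
  also have "\<dots> = 1" by (rule ring_grading.sum_component)
  finally show ?thesis
    using ring_grading.component_closed[of 1 0] by simp
qed

lemma component_scale: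
  "component B (a *s x) m = (\<Sum>n | component B x n \<noteq> 0. component A a (m - n) *s component B x n)"
proof -
  have "a *s x = (\<Sum>n | component B x n \<noteq> 0. a *s component B x n)"
    by (simp add: scale_sum_right[symmetric] module_grading.sum_component)
  then show ?thesis
    by (simp add: module_grading.component_sum
        component_scale_homogeneous_right[OF module_grading.component_closed])
qed

lemma deg_le_scale:
  assumes "a \<in> deg_le A e" "x \<in> deg_le B d"
  shows "a *s x \<in> deg_le B (e + d)"
proof -
  have "component A a (m - n) *s component B x n = 0" if "m > e + d" for m n
    using assms that by (cases "n > d") (auto simp: deg_le_def)
  then show ?thesis
    by (auto simp: deg_le_def component_scale)
qed

text \<open>In degree \<open>d\<close> only the product of the two extreme components can survive:
  above \<open>top_deg B x\<close> the component of \<open>x\<close> vanishes, below it that of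
  \<open>a\<close> does.\<close>

lemma component_scale_top:
  assumes "a \<in> deg_le A (d - top_deg B x)"
  shows "component B (a *s x) d = component A a (d - top_deg B x) *s initial B x"
proof (cases "x = 0")
  case True
  then show ?thesis by (simp add: initial_def)
next
  case False
  let ?t = "top_deg B x"
  have "component A a (d - n) *s component B x n = 0" if "n \<noteq> ?t" for n
    using that assms module_grading.component_above_top_deg[of x n]
    by (cases "n > ?t") (auto simp: deg_le_def)
  then have "component B (a *s x) d = (\<Sum>n | component B x n \<noteq> 0.
      if n = ?t then component A a (d - n) *s component B x n else 0)"
    unfolding component_scale by (intro sum.cong refl) auto
  also have "\<dots> = component A a (d - ?t) *s component B x ?t"
    using module_grading.component_top_deg_nonzero[OF False] module_grading.finite_component[of x]
    by (simp add: sum.delta')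
  finally show ?thesis by (simp add: module_grading.initial_eq)
qed

lemma deg_le_mult_homogeneous:
  assumes "a \<in> A e" "b \<in> deg_le A f"
  shows "a * b \<in> deg_le A (e + f)"
  using assms(2) component_mult_homogeneous_right[OF assms(1), of b]
  by (simp add: deg_le_def mult.commute[of a])

section \<open>Finite generation of syzygies\<close>

text \<open>A form of Schanuel's lemma: the syzygies of \<open>f\<close> are generated by the image of the syzygies of
  \<open>g\<close> under the change of generators, together with the relations expressing each \<open>f x\<close> through
  the \<open>g i\<close> and back.\<close>

lemma syzygies_finitely_generated:
  fixes f :: "'i \<Rightarrow> 'm"
  assumes X: "finite X" and pres: "finitely_presented (span (f ` X))"
  shows "\<exists>C. finite C \<and> module.span fun_scale C = syzygies X f"
proof -
  interpret F: module "fun_scale :: 'r \<Rightarrow> (nat \<Rightarrow> 'r) \<Rightarrow> nat \<Rightarrow> 'r" by (rule module_fun_scale)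
  interpret G: module "fun_scale :: 'r \<Rightarrow> ('i \<Rightarrow> 'r) \<Rightarrow> 'i \<Rightarrow> 'r" by (rule module_fun_scale)
  obtain k :: nat and g K where g: "span (g ` {..<k}) = span (f ` X)"
    and K: "finite K" "F.span K = syzygies {..<k} g"
    using pres unfolding finitely_presented_def by blast
  have "\<exists>u. f x = (\<Sum>i<k. u i *s g i)" if "x \<in> X" for x
    using that by (intro in_span_imageD) (auto simp: g intro: span_base)
  then obtain u where u: "\<And>x. x \<in> X \<Longrightarrow> f x = (\<Sum>i<k. u x i *s g i)" by metis
  have "\<exists>v. (\<forall>x. x \<notin> X \<longrightarrow> v x = 0) \<and> g i = (\<Sum>x\<in>X. v x *s f x)" if "i < k" for i
  proof -
    have "g i \<in> span (f ` X)" using that by (auto simp: g[symmetric] intro: span_base)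
    then obtain v where "g i = (\<Sum>x\<in>X. v x *s f x)" using in_span_imageD[OF _ X] by blast
    \<comment> \<open>Coefficients are cut off outside \<open>X\<close> so that
      \<open>\<phi>\<close> takes values in the free module on \<open>X\<close>.\<close>
    then show ?thesis by (intro exI[of _ "\<lambda>x. if x \<in> X then v x else 0"]) auto
  qed
  then obtain v where v0: "\<And>i x. i < k \<Longrightarrow> x \<notin> X \<Longrightarrow> v i x = 0"
    and v: "\<And>i. i < k \<Longrightarrow> g i = (\<Sum>x\<in>X. v i x *s f x)" by metis
  define \<phi> where "\<phi> c = (\<lambda>x. \<Sum>i<k. c i * v i x)" for c
  define E where "E x = (\<lambda>y. (if y = x then 1 else 0) - \<phi> (u x) y)" for x
  interpret \<phi>: module_hom "fun_scale :: 'r \<Rightarrow> (nat \<Rightarrow> 'r) \<Rightarrow> nat \<Rightarrow> 'r" "fun_scale :: 'r \<Rightarrow> ('i \<Rightarrow> 'r) \<Rightarrow> 'i \<Rightarrow> 'r" \<phi>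
  proof (intro module_hom.intro module_hom_axioms.intro module_fun_scale)
    show "\<phi> (c + c') = \<phi> c + \<phi> c'" for c c'
      by (rule ext) (simp add: \<phi>_def sum.distrib distrib_right)
    show "\<phi> (fun_scale r c) = fun_scale r (\<phi> c)" for r c
      by (rule ext) (simp add: \<phi>_def fun_scale_def sum_distrib_left mult.assoc)
  qed
  have \<phi>_outside: "\<phi> c x = 0" if "x \<notin> X" for c x
    using that by (simp add: \<phi>_def v0)
  have \<phi>_sum: "(\<Sum>x\<in>X. \<phi> c x *s f x) = (\<Sum>i<k. c i *s g i)" for c
  proof -
    have "(\<Sum>x\<in>X. \<phi> c x *s f x) = (\<Sum>x\<in>X. \<Sum>i<k. c i *s v i x *s f x)"
      by (simp add: \<phi>_def scale_sum_left)
    also have "\<dots> = (\<Sum>i<k. \<Sum>x\<in>X. c i *s v i x *s f x)" by (rule sum.swap)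
    also have "\<dots> = (\<Sum>i<k. c i *s g i)" by (simp add: v scale_sum_right)
    finally show ?thesis .
  qed
  have sub: "G.subspace (syzygies X f)"
  proof (rule G.subspaceI)
    fix r c assume c: "c \<in> syzygies X f"
    have "(\<Sum>x\<in>X. fun_scale r c x *s f x) = r *s (\<Sum>x\<in>X. c x *s f x)"
      by (simp add: fun_scale_def scale_sum_right)
    then show "fun_scale r c \<in> syzygies X f"
      using c by (simp add: in_syzygies_iff[OF X] fun_scale_def)
  qed (auto simp: in_syzygies_iff[OF X] scale_left_distrib sum.distrib)
  have "G.span (\<phi> ` K \<union> E ` X) = syzygies X f"
  proof
    have "\<phi> c \<in> syzygies X f" if "c \<in> K" for c
    proof -
      have "c \<in> syzygies {..<k} g" using that K(2) F.span_base by blast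
      then show ?thesis by (auto simp: in_syzygies_iff X \<phi>_outside \<phi>_sum)
    qed
    moreover have "E x \<in> syzygies X f" if "x \<in> X" for x
    proof -
      have "(\<Sum>y\<in>X. (if y = x then 1 else 0) *s f y) = (\<Sum>y\<in>X. if y = x then f y else 0)"
        by (intro sum.cong) auto
      also have "\<dots> = f x" using that X by (simp add: sum.delta')
      finally have "(\<Sum>y\<in>X. E x y *s f y) = f x - f x"
        by (simp add: E_def scale_left_diff_distrib sum_subtractf \<phi>_sum u[OF that, symmetric])
      then show ?thesis using that by (auto simp: in_syzygies_iff X E_def \<phi>_outside)
    qed
    ultimately show "G.span (\<phi> ` K \<union> E ` X) \<subseteq> syzygies X f"
      by (intro G.span_minimal sub) auto
  next
    show "syzygies X f \<subseteq> G.span (\<phi> ` K \<union> E ` X)"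
    proof
      fix c assume "c \<in> syzygies X f"
      then have c0: "\<And>x. x \<notin> X \<Longrightarrow> c x = 0" and c: "(\<Sum>x\<in>X. c x *s f x) = 0"
        by (auto simp: in_syzygies_iff X)
      \<comment> \<open>The syzygy \<open>c\<close>, rewritten in the generators \<open>g i\<close>
        by substituting the expressions \<open>u\<close>.\<close>
      define c' where "c' i = (if i < k then \<Sum>x\<in>X. c x * u x i else 0)" for i
      have "(\<Sum>i<k. c' i *s g i) = (\<Sum>i<k. \<Sum>x\<in>X. c x *s u x i *s g i)"
        by (simp add: c'_def scale_sum_left)
      also have "\<dots> = (\<Sum>x\<in>X. \<Sum>i<k. c x *s u x i *s g i)" by (rule sum.swap)
      also have "\<dots> = (\<Sum>x\<in>X. c x *s f x)" by (simp add: u scale_sum_right)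
      finally have "c' \<in> F.span K" by (simp add: K(2) in_syzygies_iff c c'_def)
      then have "\<phi> c' \<in> G.span (\<phi> ` K)" by (simp add: \<phi>.span_image)
      then have "\<phi> c' \<in> G.span (\<phi> ` K \<union> E ` X)"
        using G.span_mono[of "\<phi> ` K" "\<phi> ` K \<union> E ` X"] by blast
      moreover have "(\<Sum>x\<in>X. fun_scale (c x) (E x)) \<in> G.span (\<phi> ` K \<union> E ` X)"
        by (intro G.span_sum G.span_scale G.span_base) auto
      ultimately have "\<phi> c' + (\<Sum>x\<in>X. fun_scale (c x) (E x)) \<in> G.span (\<phi> ` K \<union> E ` X)"
        by (rule G.span_add)
      \<comment> \<open>By definition of \<open>E\<close>, the basis vector at \<open>x\<close> is
        \<open>E x + \<phi> (u x)\<close>. Multiplying by \<open>c x\<close> and summing gives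
        \<open>c\<close>, because \<open>\<phi>\<close> is linear and \<open>c'\<close> is the sum
        of the \<open>c x\<close> times \<open>u x\<close>.\<close>
      also have "\<phi> c' + (\<Sum>x\<in>X. fun_scale (c x) (E x)) = c"
      proof
        fix y
        have "(\<Sum>x\<in>X. c x * (if y = x then 1 else 0)) = (\<Sum>x\<in>X. if y = x then c x else 0)"
          by (intro sum.cong) auto
        also have "\<dots> = c y" using X c0 by (simp add: sum.delta')
        finally have 1: "(\<Sum>x\<in>X. c x * (if y = x then 1 else 0)) = c y" .
        have "\<phi> c' y = (\<Sum>i<k. \<Sum>x\<in>X. c x * (u x i * v i y))"
          by (simp add: \<phi>_def c'_def sum_distrib_right mult.assoc)
        also have "\<dots> = (\<Sum>x\<in>X. \<Sum>i<k. c x * (u x i * v i y))" by (rule sum.swap)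
        also have "\<dots> = (\<Sum>x\<in>X. c x * \<phi> (u x) y)" by (simp add: \<phi>_def sum_distrib_left)
        finally show "(\<phi> c' + (\<Sum>x\<in>X. fun_scale (c x) (E x))) y = c y"
          using 1 by (simp add: sum_fun_apply fun_scale_def E_def right_diff_distrib sum_subtractf)
      qed
      finally show "c \<in> G.span (\<phi> ` K \<union> E ` X)" .
    qed
  qed
  moreover have "finite (\<phi> ` K \<union> E ` X)" using K(1) X by simp
  ultimately show ?thesis by (intro exI conjI)
qed

section \<open>Homogeneous generators of the syzygies of initial terms\<close>

lemma homogeneous_submodule_span_initial:
  assumes "finite X"
  shows "homogeneous_submodule (span (initial B ` X))"
  unfolding homogeneous_submodule_def
proof (intro conjI ballI allI)
  fix w n assume "w \<in> span (initial B ` X)"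
  then obtain a where "w = (\<Sum>x\<in>X. a x *s initial B x)"
    using in_span_imageD assms by blast
  then show "component B w n \<in> span (initial B ` X)"
    by (simp add: module_grading.component_sum sum_in_span_image
        component_scale_homogeneous_right[OF module_grading.initial_closed])
qed simp

text \<open>The degree \<open>d\<close> component in the free module whose basis vector at
  \<open>x\<close> has degree \<open>top_deg B x\<close>.\<close>

definition syzygy_component :: "int \<Rightarrow> ('m \<Rightarrow> 'r) \<Rightarrow> 'm \<Rightarrow> 'r" where
  "syzygy_component d c = (\<lambda>x. component A (c x) (d - top_deg B x))"

lemma syzygy_component_in_syzygies:
  assumes "finite X" "c \<in> syzygies X (initial B)"
  shows "syzygy_component d c \<in> syzygies X (initial B)"
proof -
  have "(\<Sum>x\<in>X. syzygy_component d c x *s initial B x) = component B (\<Sum>x\<in>X. c x *s initial B x) d"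
    by (simp add: module_grading.component_sum syzygy_component_def
        component_scale_homogeneous_right[OF module_grading.initial_closed])
  then show ?thesis
    using assms by (simp add: in_syzygies_iff syzygy_component_def)
qed

lemma deg_add_eq_Fin: "a \<in> A (d - top_deg B x) \<Longrightarrow> a \<noteq> 0 \<Longrightarrow> x \<noteq> 0 \<Longrightarrow> deg A a + deg B x = Fin d"
  by (simp add: deg_def ring_grading.top_deg_homogeneous)

text \<open>The position 0 has to carry coefficient 0: \<open>deg B 0\<close> is
  \<open>Minf\<close>, which would spoil the common finite degree \<open>d\<close>.\<close>

lemma homogeneous_coeffs_syzygy_component:
  assumes "\<And>x. c x \<noteq> 0 \<Longrightarrow> x \<noteq> 0"
  shows "homogeneous_coeffs (syzygy_component d c)"
  unfolding homogeneous_coeffs_def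
proof (intro conjI allI exI[of _ "Fin d"] impI)
  fix x
  show "homogeneous A (syzygy_component d c x)"
    by (simp add: syzygy_component_def ring_grading.homogeneous_component)
  assume "syzygy_component d c x \<noteq> 0"
  moreover from this have "x \<noteq> 0"
    using assms[of x] by (cases "c x = 0") (auto simp: syzygy_component_def)
  ultimately show "deg A (syzygy_component d c x) + deg B x = Fin d"
    by (intro deg_add_eq_Fin) (simp_all add: syzygy_component_def ring_grading.component_closed)
qed

lemma syzygy_choice_exists:
  assumes X: "finite X" "0 \<notin> X" and coh: graded_coherent
  shows "\<exists>C. syzygy_choice X C"
proof -
  interpret G: module "fun_scale :: 'r \<Rightarrow> ('m \<Rightarrow> 'r) \<Rightarrow> 'm \<Rightarrow> 'r" by (rule module_fun_scale)
  have "finitely_generated (span (initial B ` X))"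
    using X unfolding finitely_generated_def by blast
  then have "finitely_presented (span (initial B ` X))"
    using coh homogeneous_submodule_span_initial[OF X(1)] by (auto simp: graded_coherent_def)
  then obtain C where C: "finite C" "G.span C = syzygies X (initial B)"
    using syzygies_finitely_generated[OF X(1)] by blast
  have C_syz: "c \<in> syzygies X (initial B)" if "c \<in> C" for c
    using that C(2) G.span_base by blast
  then have C0: "c x = 0" if "c \<in> C" "x \<notin> X" for c x
    using that X by (auto simp: in_syzygies_iff)
  \<comment> \<open>Component \<open>n\<close> of the coefficient at \<open>x\<close> contributes to
    degree \<open>n + top_deg B x\<close>, so \<open>D c\<close> collects the finitely many degrees
    in which \<open>c\<close> lives.\<close>
  define D where "D c = (\<Union>x\<in>X. (\<lambda>n. n + top_deg B x) ` {n. component A (c x) n \<noteq> 0})" for c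
  have finD: "finite (D c)" for c
    by (simp add: D_def X ring_grading.finite_component)
  define C' where "C' = (\<Union>c\<in>C. (\<lambda>d. syzygy_component d c) ` D c)"
  have sum_D: "c = (\<Sum>d\<in>D c. syzygy_component d c)" if "c \<in> C" for c
  proof
    fix x
    let ?t = "top_deg B x"
    show "c x = (\<Sum>d\<in>D c. syzygy_component d c) x"
    proof (cases "x \<in> X")
      case True
      have inj: "inj_on (\<lambda>d. d - ?t) (D c)" by (auto simp: inj_on_def)
      have "(\<Sum>d\<in>D c. syzygy_component d c) x = sum (component A (c x)) ((\<lambda>d. d - ?t) ` D c)"
        by (simp add: sum_fun_apply syzygy_component_def sum.reindex[OF inj])
      also have "\<dots> = c x"
      proof (rule ring_grading.sum_component_superset)
        show "{n. component A (c x) n \<noteq> 0} \<subseteq> (\<lambda>d. d - ?t) ` D c"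
        proof
          fix n assume "n \<in> {n. component A (c x) n \<noteq> 0}"
          then have "n + ?t \<in> D c" using True by (auto simp: D_def)
          then show "n \<in> (\<lambda>d. d - ?t) ` D c" by (rule rev_image_eqI) simp
        qed
      qed (simp add: finD)
      finally show ?thesis by simp
    qed (simp add: C0[OF that] sum_fun_apply syzygy_component_def)
  qed
  have "G.span C' = syzygies X (initial B)"
  proof
    have "C' \<subseteq> syzygies X (initial B)"
      using syzygy_component_in_syzygies[OF X(1) C_syz] by (auto simp: C'_def)
    then have "C' \<subseteq> G.span C" by (simp add: C)
    then show "G.span C' \<subseteq> syzygies X (initial B)"
      unfolding C(2)[symmetric] by (intro G.span_minimal G.subspace_span)
    have "c \<in> G.span C'" if "c \<in> C" for c
      by (subst sum_D[OF that], intro G.span_sum G.span_base) (use that in \<open>auto simp: C'_def\<close>)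
    then show "syzygies X (initial B) \<subseteq> G.span C'"
      unfolding C(2)[symmetric] by (intro G.span_minimal G.subspace_span) auto
  qed
  moreover have "homogeneous_coeffs c" if c_in: "c \<in> C'" for c
  proof -
    obtain d c' where c: "c = syzygy_component d c'" "c' \<in> C"
      using c_in unfolding C'_def by blast
    have "c' x \<noteq> 0 \<Longrightarrow> x \<noteq> 0" for x
      using C0[OF c(2), of x] X(2) by auto
    then show ?thesis unfolding c(1) by (rule homogeneous_coeffs_syzygy_component)
  qed
  moreover have "finite C'" by (simp add: C'_def C finD)
  ultimately show ?thesis by (auto simp: syzygy_choice_def)
qed

section \<open>Expressions of bounded degree\<close>

text \<open>For finite \<open>X\<close> this filters \<open>span X\<close> by the largest degree of
  a term. The bound \<open>d\<close> is decoupled from the degree of the element, so that it can be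
  lowered one unit at a time until the expression is reduced.\<close>

definition expr_le :: "'m set \<Rightarrow> int \<Rightarrow> 'm set" where
  "expr_le X d = {(\<Sum>x\<in>X. a x *s x) | a. \<forall>x\<in>X. a x \<in> deg_le A (d - top_deg B x)}"

lemma expr_leI: "(\<And>x. x \<in> X \<Longrightarrow> a x \<in> deg_le A (d - top_deg B x)) \<Longrightarrow> (\<Sum>x\<in>X. a x *s x) \<in> expr_le X d"
  by (auto simp: expr_le_def)

lemma expr_le_zero: "0 \<in> expr_le X d"
  using expr_leI[of X "\<lambda>_. 0"] by simp

lemma expr_le_add:
  assumes "y \<in> expr_le X d" "z \<in> expr_le X d"
  shows "y + z \<in> expr_le X d"
proof -
  obtain a where a: "y = (\<Sum>x\<in>X. a x *s x)" "\<And>x. x \<in> X \<Longrightarrow> a x \<in> deg_le A (d - top_deg B x)"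
    using assms(1) unfolding expr_le_def by blast
  obtain b where b: "z = (\<Sum>x\<in>X. b x *s x)" "\<And>x. x \<in> X \<Longrightarrow> b x \<in> deg_le A (d - top_deg B x)"
    using assms(2) unfolding expr_le_def by blast
  have "y + z = (\<Sum>x\<in>X. (a x + b x) *s x)"
    by (simp add: a(1) b(1) scale_left_distrib sum.distrib)
  then show ?thesis
    using expr_leI[of X "\<lambda>x. a x + b x"] a(2) b(2) ring_grading.deg_le_add by simp
qed

lemma expr_le_sum: "(\<And>s. s \<in> S \<Longrightarrow> f s \<in> expr_le X d) \<Longrightarrow> sum f S \<in> expr_le X d"
  by (induction S rule: infinite_finite_induct) (auto intro: expr_le_zero expr_le_add)

lemma expr_le_mono:
  assumes "y \<in> expr_le X d" "d \<le> d'"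
  shows "y \<in> expr_le X d'"
proof -
  obtain a where a: "y = (\<Sum>x\<in>X. a x *s x)" "\<And>x. x \<in> X \<Longrightarrow> a x \<in> deg_le A (d - top_deg B x)"
    using assms(1) unfolding expr_le_def by blast
  show ?thesis
    unfolding a(1) using assms(2) by (intro expr_leI ring_grading.deg_le_mono[OF a(2)]) auto
qed

lemma expr_le_superset:
  assumes "y \<in> expr_le X d" "X \<subseteq> X'" "finite X'"
  shows "y \<in> expr_le X' d"
proof -
  obtain a where a: "y = (\<Sum>x\<in>X. a x *s x)" "\<And>x. x \<in> X \<Longrightarrow> a x \<in> deg_le A (d - top_deg B x)"
    using assms(1) unfolding expr_le_def by blast
  have "y = (\<Sum>x\<in>X'. (if x \<in> X then a x else 0) *s x)"
    unfolding a(1) using assms by (intro sum.mono_neutral_cong_left) auto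
  then show ?thesis
    using expr_leI[of X' "\<lambda>x. if x \<in> X then a x else 0" d] a(2) by simp
qed

lemma expr_le_scale:
  assumes "b \<in> A e" "y \<in> expr_le X d"
  shows "b *s y \<in> expr_le X (e + d)"
proof -
  obtain a where a: "y = (\<Sum>x\<in>X. a x *s x)" "\<And>x. x \<in> X \<Longrightarrow> a x \<in> deg_le A (d - top_deg B x)"
    using assms(2) unfolding expr_le_def by blast
  have "b *s y = (\<Sum>x\<in>X. (b * a x) *s x)"
    by (simp add: a(1) scale_sum_right)
  moreover have "b * a x \<in> deg_le A (e + d - top_deg B x)" if "x \<in> X" for x
    using deg_le_mult_homogeneous[OF assms(1) a(2)[OF that]] by (simp add: algebra_simps)
  ultimately show ?thesis using expr_leI[of X "\<lambda>x. b * a x"] by simp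
qed

lemma generator_in_expr_le:
  assumes "finite X" "x \<in> X"
  shows "x \<in> expr_le X (top_deg B x)"
proof -
  have "x = (\<Sum>x'\<in>X. if x' = x then x' else 0)"
    using assms by (simp add: sum.delta')
  also have "\<dots> = (\<Sum>x'\<in>X. (if x' = x then 1 else 0) *s x')"
    by (intro sum.cong) auto
  also have "\<dots> \<in> expr_le X (top_deg B x)"
    using ring_grading.homogeneous_deg_le[OF one_in_degree_zero] by (intro expr_leI) auto
  finally show ?thesis .
qed

lemma expr_le_deg_le:
  assumes "y \<in> expr_le X d"
  shows "y \<in> deg_le B d"
proof -
  obtain a where a: "y = (\<Sum>x\<in>X. a x *s x)" "\<And>x. x \<in> X \<Longrightarrow> a x \<in> deg_le A (d - top_deg B x)"
    using assms unfolding expr_le_def by blast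
  have "a x *s x \<in> deg_le B d" if "x \<in> X" for x
    using deg_le_scale[OF a(2)[OF that] module_grading.deg_le_top_deg[of x]] by simp
  then show "y \<in> deg_le B d"
    unfolding a(1) by (simp add: deg_le_def module_grading.component_sum)
qed

text \<open>The link between expressions and initial terms: the top degree part of an expression is
  the combination of initial terms with the leading coefficients. If it vanishes, these coefficients
  are a syzygy.\<close>

lemma component_expr:
  assumes "\<And>x. x \<in> X \<Longrightarrow> a x \<in> deg_le A (d - top_deg B x)"
  shows "component B (\<Sum>x\<in>X. a x *s x) d = (\<Sum>x\<in>X. component A (a x) (d - top_deg B x) *s initial B x)"
  unfolding module_grading.component_sum
  by (intro sum.cong refl component_scale_top assms)

lemma span_in_expr_le:
  assumes "finite X" "y \<in> span X"
  shows "\<exists>d. y \<in> expr_le X d"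
proof -
  obtain a where y: "y = (\<Sum>x\<in>X. a x *s x)"
    using in_span_imageD[of y "\<lambda>x. x" X] assms by auto
  \<comment> \<open>Inserting 0 keeps the maximum defined for empty \<open>X\<close>.\<close>
  define d where "d = Max (insert 0 ((\<lambda>x. top_deg A (a x) + top_deg B x) ` X))"
  have "top_deg A (a x) + top_deg B x \<le> d" if "x \<in> X" for x
    unfolding d_def using that assms by (intro Max_ge) auto
  then have "a x \<in> deg_le A (d - top_deg B x)" if "x \<in> X" for x
    using that by (force simp: ring_grading.deg_le_iff)
  then show ?thesis unfolding y by (blast intro: expr_leI)
qed

text \<open>Translates extended degrees into the integer bounds of \<open>expr_le\<close>. The zero
  vector is kept apart, both in \<open>X\<close> and as \<open>y\<close>, since
  \<open>top_deg\<close> only reflects the degree of nonzero elements.\<close>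

lemma has_reduced_expression_iff:
  assumes "finite X" "0 \<notin> X"
  shows "has_reduced_expression X y \<longleftrightarrow> y = 0 \<or> y \<in> expr_le X (top_deg B y)"
proof -
  have le: "deg A b + deg B x \<le> deg B y \<longleftrightarrow> b \<in> deg_le A (top_deg B y - top_deg B x)"
    if "x \<in> X" "y \<noteq> 0" for b x
    using that assms by (auto simp: deg_def ring_grading.deg_le_iff)
  show ?thesis
  proof
    assume "has_reduced_expression X y"
    then obtain a where "y = (\<Sum>x\<in>X. a x *s x)" "\<forall>x\<in>X. deg A (a x) + deg B x \<le> deg B y"
      using assms(1) by (auto simp: has_reduced_expression_def lincomb_eq_sum)
    then show "y = 0 \<or> y \<in> expr_le X (top_deg B y)"
      using expr_leI[of X a "top_deg B y"] le by (cases "y = 0") auto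
  next
    assume "y = 0 \<or> y \<in> expr_le X (top_deg B y)"
    then show "has_reduced_expression X y"
    proof
      assume [simp]: "y = 0"
      have "deg A 0 + deg B x \<le> deg B 0" if "x \<in> X" for x
        using that assms by (auto simp: deg_def)
      moreover have "(\<lambda>_. 0) \<in> free_module X" by (simp add: free_module_def)
      moreover have "lincomb (\<lambda>_. 0) (\<lambda>x. x) = 0" by (simp add: lincomb_def)
      ultimately show ?thesis
        unfolding has_reduced_expression_def by (intro bexI[of _ "\<lambda>_. 0"]) auto
    next
      assume "y \<in> expr_le X (top_deg B y)"
      then obtain a where a: "y = (\<Sum>x\<in>X. a x *s x)"
        "\<And>x. x \<in> X \<Longrightarrow> a x \<in> deg_le A (top_deg B y - top_deg B x)"
        unfolding expr_le_def by blast
      \<comment> \<open>For \<open>y = 0\<close> the bound is \<open>Minf\<close>, which forces all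
        coefficients to be 0; outside \<open>X\<close> they vanish to stay in the free
        module.\<close>
      define a' where "a' x = (if x \<in> X \<and> y \<noteq> 0 then a x else 0)" for x
      have "a' \<in> free_module X"
        using assms(1) by (intro in_free_moduleI) (auto simp: a'_def)
      moreover have "y = lincomb a' (\<lambda>x. x)"
        using a(1) by (cases "y = 0")
          (auto simp: lincomb_eq_sum[OF assms(1) calculation] a'_def intro: sum.cong)
      moreover have "\<forall>x\<in>X. deg A (a' x) + deg B x \<le> deg B y"
      proof (cases "y = 0")
        case True
        then show ?thesis using assms by (auto simp: a'_def deg_def)
      next
        case False
        then show ?thesis using a(2) by (auto simp: le a'_def)
      qed
      ultimately show ?thesis
        unfolding has_reduced_expression_def by blast
    qed
  qed
qed

section \<open>Lifted syzygies\<close>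

text \<open>The common degree is an extended integer. It is finite as soon as some coefficient is
  nonzero, because that coefficient sits at a nonzero \<open>x\<close>; the zero family fits any
  \<open>d\<close>.\<close>

lemma homogeneous_coeffsE:
  assumes "homogeneous_coeffs c" "0 \<notin> X" "\<And>x. x \<notin> X \<Longrightarrow> c x = 0"
  obtains d where "\<And>x. c x \<in> A (d - top_deg B x)"
proof (cases "\<exists>x. c x \<noteq> 0")
  case False
  then show ?thesis by (intro that[of 0]) (auto intro: ring_grading.zero_closed)
next
  case True
  obtain d' where d': "\<And>x. c x \<noteq> 0 \<Longrightarrow> deg A (c x) + deg B x = d'"
    using assms(1) by (auto simp: homogeneous_coeffs_def)
  have nz: "x \<noteq> 0" if "c x \<noteq> 0" for x
    using that assms by auto
  from True obtain x0 where "c x0 \<noteq> 0" by blast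
  define d where "d = top_deg A (c x0) + top_deg B x0"
  have d'_eq: "d' = Fin d"
    using d'[OF \<open>c x0 \<noteq> 0\<close>] nz[OF \<open>c x0 \<noteq> 0\<close>] \<open>c x0 \<noteq> 0\<close> by (simp add: deg_def d_def)
  have "c x \<in> A (d - top_deg B x)" for x
  proof (cases "c x = 0")
    case True
    then show ?thesis by (simp add: ring_grading.zero_closed)
  next
    case False
    obtain n where n: "c x \<in> A n"
      using assms(1) by (auto simp: homogeneous_coeffs_def homogeneous_def)
    have "top_deg A (c x) + top_deg B x = d"
      using d'[OF False] False nz[OF False] by (simp add: d'_eq deg_def)
    then have "n = d - top_deg B x"
      using ring_grading.top_deg_homogeneous[OF n False] by simp
    then show ?thesis using n by simp
  qed
  then show ?thesis by (rule that)
qed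

text \<open>The degree \<open>d\<close> part of the lift is the syzygy evaluated at the initial
  terms, hence 0. This is the cancellation familiar from S-polynomials.\<close>

lemma lift_drops_degree:
  assumes X: "finite X" and c: "c \<in> syzygies X (initial B)" "\<And>x. c x \<in> A (d - top_deg B x)"
  shows "lincomb c (\<lambda>x. x) \<in> deg_le B (d - 1)"
proof -
  have c_le: "c x \<in> deg_le A (d - top_deg B x)" for x
    by (rule ring_grading.homogeneous_deg_le[OF c(2)])
  have lc: "lincomb c (\<lambda>x. x) = (\<Sum>x\<in>X. c x *s x)"
    using c(1) by (intro lincomb_eq_sum X) (simp add: syzygies_def)
  have "component B (\<Sum>x\<in>X. c x *s x) d = (\<Sum>x\<in>X. c x *s initial B x)"
    by (simp add: component_expr[OF c_le] ring_grading.component_homogeneous[OF c(2)])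
  also have "\<dots> = 0" using c(1) X by (simp add: in_syzygies_iff)
  finally have "component B (\<Sum>x\<in>X. c x *s x) d = 0" .
  then show ?thesis
    unfolding lc by (intro module_grading.deg_le_pred expr_le_deg_le[OF expr_leI] c_le)
qed

text \<open>The leading coefficients of an expression of \<open>y\<close> of degree \<open>d\<close> larger than the degree of \<open>y\<close>
  form a homogeneous syzygy of the initial terms; rewriting it through the chosen generators and
  lifting replaces the leading part by an expression of smaller degree.\<close>

lemma expr_le_decrease:
  assumes X: "finite X" "0 \<notin> X" and C: "syzygy_choice X C"
    and X': "X \<subseteq> X'" "finite X'"
    and lift: "\<And>c. c \<in> C \<Longrightarrow> lincomb c (\<lambda>x. x) = 0 \<or>
      lincomb c (\<lambda>x. x) \<in> expr_le X' (top_deg B (lincomb c (\<lambda>x. x)))"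
    and y: "y \<in> expr_le X d" "y \<in> deg_le B (d - 1)"
  shows "y \<in> expr_le X' (d - 1)"
proof -
  interpret G: module "fun_scale :: 'r \<Rightarrow> ('m \<Rightarrow> 'r) \<Rightarrow> 'm \<Rightarrow> 'r" by (rule module_fun_scale)
  let ?t = "top_deg B"
  have finC: "finite C" and homC: "\<And>c. c \<in> C \<Longrightarrow> homogeneous_coeffs c"
    and spanC: "G.span C = syzygies X (initial B)"
    using C by (auto simp: syzygy_choice_def)
  have C_syz: "c \<in> syzygies X (initial B)" if "c \<in> C" for c
    using that spanC G.span_base by blast
  then have C0: "c x = 0" if "c \<in> C" "x \<notin> X" for c x
    using that X by (auto simp: in_syzygies_iff)
  have "\<exists>e. \<forall>x. c x \<in> A (e - ?t x)" if "c \<in> C" for c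
    using homogeneous_coeffsE[OF homC[OF that] X(2) C0[OF that]] by blast
  then obtain e where e: "\<And>c x. c \<in> C \<Longrightarrow> c x \<in> A (e c - ?t x)" by metis
  \<comment> \<open>The lift has degree at most \<open>e c - 1\<close>, so an expression bounded by
    its own degree is bounded by \<open>e c - 1\<close> as well.\<close>
  have lift_le: "lincomb c (\<lambda>x. x) \<in> expr_le X' (e c - 1)" if "c \<in> C" for c
    using lift[OF that] lift_drops_degree[OF X(1) C_syz[OF that] e[OF that]]
    by (auto simp: module_grading.deg_le_iff intro: expr_le_mono expr_le_zero)
  obtain a where a: "y = (\<Sum>x\<in>X. a x *s x)" "\<And>x. x \<in> X \<Longrightarrow> a x \<in> deg_le A (d - ?t x)"
    using y(1) unfolding expr_le_def by blast
  define h where "h x = (if x \<in> X then component A (a x) (d - ?t x) else 0)" for x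
  have "(\<Sum>x\<in>X. h x *s initial B x) = component B y d"
    unfolding a(1) by (subst component_expr) (simp_all add: a(2) h_def)
  also have "\<dots> = 0" using y(2) by (simp add: deg_le_def)
  finally have "h \<in> G.span C" by (simp add: spanC in_syzygies_iff[OF X(1)] h_def)
  then obtain b where b: "h = (\<Sum>c\<in>C. fun_scale (b c) c)"
    using G.in_span_imageD[of h "\<lambda>c. c" C] finC by auto
  \<comment> \<open>The coefficients \<open>b c\<close> obtained from the span need not be
    homogeneous. As \<open>h\<close> is homogeneous of degree \<open>d\<close> and \<open>c\<close>
    of degree \<open>e c\<close>, their components of degree \<open>d - e c\<close> suffice to
    represent \<open>h\<close>.\<close>
  define b' where "b' c = component A (b c) (d - e c)" for c
  have h_eq: "h x = (\<Sum>c\<in>C. b' c * c x)" if "x \<in> X" for x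
  proof -
    have "h x = component A (h x) (d - ?t x)"
      using that by (simp add: h_def ring_grading.component_homogeneous[OF ring_grading.component_closed])
    also have "\<dots> = (\<Sum>c\<in>C. component A (b c * c x) (d - ?t x))"
      by (simp add: b sum_fun_apply fun_scale_def ring_grading.component_sum)
    also have "\<dots> = (\<Sum>c\<in>C. b' c * c x)"
      by (intro sum.cong refl) (simp add: component_mult_homogeneous_right[OF e] b'_def)
    finally show ?thesis .
  qed
  have "(\<Sum>x\<in>X. h x *s x) = (\<Sum>x\<in>X. \<Sum>c\<in>C. b' c *s c x *s x)"
    by (simp add: h_eq scale_sum_left)
  also have "\<dots> = (\<Sum>c\<in>C. \<Sum>x\<in>X. b' c *s c x *s x)" by (rule sum.swap)
  also have "\<dots> = (\<Sum>c\<in>C. b' c *s lincomb c (\<lambda>x. x))"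
    using C_syz by (intro sum.cong refl)
      (simp add: lincomb_eq_sum[OF X(1)] syzygies_def scale_sum_right)
  finally have leading: "(\<Sum>x\<in>X. h x *s x) = (\<Sum>c\<in>C. b' c *s lincomb c (\<lambda>x. x))" .
  have "b' c *s lincomb c (\<lambda>x. x) \<in> expr_le X' (d - 1)" if "c \<in> C" for c
    using expr_le_scale[OF ring_grading.component_closed lift_le[OF that], of "b c" "d - e c"]
    by (simp add: b'_def algebra_simps)
  then have leading_le: "(\<Sum>x\<in>X. h x *s x) \<in> expr_le X' (d - 1)"
    unfolding leading by (rule expr_le_sum)
  \<comment> \<open>Subtracting \<open>h\<close> removes exactly the leading components, so the
    remaining terms have degree below \<open>d\<close>.\<close>
  have "a x - h x \<in> deg_le A (d - 1 - ?t x)" if "x \<in> X" for x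
  proof -
    have h: "h x \<in> A (d - ?t x)"
      using that by (simp add: h_def ring_grading.component_closed)
    have "component A (a x - h x) (d - ?t x) = 0"
      using that by (simp add: ring_grading.component_diff ring_grading.component_homogeneous[OF h])
        (simp add: h_def)
    then have "a x - h x \<in> deg_le A (d - ?t x - 1)"
      using ring_grading.deg_le_diff[OF a(2)[OF that] ring_grading.homogeneous_deg_le[OF h]]
      by (intro ring_grading.deg_le_pred)
    then show ?thesis by (simp add: algebra_simps)
  qed
  then have "(\<Sum>x\<in>X. (a x - h x) *s x) \<in> expr_le X' (d - 1)"
    by (intro expr_le_superset[OF expr_leI X'])
  then have "(\<Sum>x\<in>X. (a x - h x) *s x) + (\<Sum>x\<in>X. h x *s x) \<in> expr_le X' (d - 1)"
    using leading_le by (rule expr_le_add)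
  then show ?thesis
    by (simp add: a(1) scale_left_diff_distrib sum_subtractf)
qed

section \<open>Termination and correctness\<close>

lemma initial_in_span_initial:
  assumes "y \<noteq> 0" "y \<in> expr_le X (top_deg B y)"
  shows "initial B y \<in> span (initial B ` X)"
proof -
  obtain a where a: "y = (\<Sum>x\<in>X. a x *s x)" "\<And>x. x \<in> X \<Longrightarrow> a x \<in> deg_le A (top_deg B y - top_deg B x)"
    using assms(2) unfolding expr_le_def by blast
  have "initial B y = component B (\<Sum>x\<in>X. a x *s x) (top_deg B y)"
    by (simp add: module_grading.initial_eq flip: a(1))
  also have "\<dots> \<in> span (initial B ` X)"
    by (subst component_expr) (rule a(2), assumption, rule sum_in_span_image)
  finally show ?thesis .
qed

lemma groebner_basisI:
  assumes "X \<subseteq> N" "0 \<notin> X"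
    and "\<And>y. y \<in> N \<Longrightarrow> y \<noteq> 0 \<Longrightarrow> initial B y \<in> span (initial B ` X)"
  shows "groebner_basis X N"
  unfolding groebner_basis_def initial_submodule_def
proof (intro conjI equalityI assms(1))
  show "span (initial B ` X) \<subseteq> span (initial B ` (N - {0}))"
    using assms by (intro span_mono) auto
  show "span (initial B ` (N - {0})) \<subseteq> span (initial B ` X)"
    using assms by (intro span_minimal) auto
qed

text \<open>Division by the Groebner basis stops because the module vanishes in small degrees.\<close>

lemma groebner_basis_expr_le:
  assumes X: "finite X" and gb: "groebner_basis X N" and N: "subspace N"
    and "y \<in> N" "y \<in> deg_le B d"
  shows "y \<in> expr_le X d"
proof -
  obtain n0 where n0: "\<And>n. n < n0 \<Longrightarrow> B n = {0}" using bounded_below by blast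
  \<comment> \<open>Induction on the number of degrees from \<open>n0\<close> to \<open>d\<close>.
    It is 0 exactly when \<open>d < n0\<close>, and then \<open>y = 0\<close>.\<close>
  have "\<forall>y\<in>N. y \<in> deg_le B d \<longrightarrow> nat (d - n0 + 1) = k \<longrightarrow> y \<in> expr_le X d" for k
  proof (induction k arbitrary: d)
    case 0
    show ?case
    proof (intro ballI impI)
      fix y assume "y \<in> N" and y: "y \<in> deg_le B d" and "nat (d - n0 + 1) = 0"
      then have "d < n0" by simp
      have "y = 0"
      proof (rule ccontr)
        assume "y \<noteq> 0"
        then have "component B y (top_deg B y) \<noteq> 0" "top_deg B y < n0"
          using module_grading.component_top_deg_nonzero y \<open>d < n0\<close>
          by (auto simp: module_grading.deg_le_iff)
        then show False
          using n0 module_grading.component_closed[of y "top_deg B y"] by auto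
      qed
      then show "y \<in> expr_le X d" by (simp add: expr_le_zero)
    qed
  next
    case (Suc k)
    show ?case
    proof (intro ballI impI)
      fix y assume yN: "y \<in> N" and y: "y \<in> deg_le B d" and k: "nat (d - n0 + 1) = Suc k"
      let ?w = "component B y d"
      have "?w \<in> span (initial B ` X)"
      proof (cases "?w = 0")
        case False
        then have "y \<noteq> 0" by auto
        moreover from this have "top_deg B y = d"
          using False y module_grading.component_above_top_deg[of y d]
          by (force simp: module_grading.deg_le_iff)
        ultimately have "?w = initial B y" by (simp add: module_grading.initial_eq)
        moreover have "initial B y \<in> span (initial B ` (N - {0}))"
          using yN \<open>y \<noteq> 0\<close> by (intro span_base) auto
        ultimately show ?thesis
          using gb by (simp add: groebner_basis_def initial_submodule_def)
      qed (simp add: span_zero)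
      then obtain a where a: "?w = (\<Sum>x\<in>X. a x *s initial B x)"
        using in_span_imageD X by blast
      \<comment> \<open>Only these components of the coefficients contribute to degree
        \<open>d\<close>. They give the same top part \<open>?w\<close> and keep every term within
        the bound, so subtracting \<open>?s\<close> lowers the degree inside
        \<open>N\<close>.\<close>
      define h where "h x = component A (a x) (d - top_deg B x)" for x
      have h: "h x \<in> A (d - top_deg B x)" for x
        by (simp add: h_def ring_grading.component_closed)
      then have h_le: "h x \<in> deg_le A (d - top_deg B x)" for x
        by (rule ring_grading.homogeneous_deg_le)
      let ?s = "\<Sum>x\<in>X. h x *s x"
      have s: "?s \<in> expr_le X d" by (rule expr_leI) (rule h_le)
      have "component B ?s d = (\<Sum>x\<in>X. h x *s initial B x)"
        by (simp add: component_expr[OF h_le] ring_grading.component_homogeneous[OF h])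
      also have "\<dots> = component B ?w d"
        unfolding a by (simp add: module_grading.component_sum h_def
            component_scale_homogeneous_right[OF module_grading.initial_closed])
      also have "\<dots> = ?w"
        by (simp add: module_grading.component_homogeneous[OF module_grading.component_closed])
      finally have "component B (y - ?s) d = 0" by (simp add: module_grading.component_diff)
      then have le: "y - ?s \<in> deg_le B (d - 1)"
        using module_grading.deg_le_diff[OF y expr_le_deg_le[OF s]] module_grading.deg_le_pred by blast
      have "x \<in> N" if "x \<in> X" for x using that gb by (auto simp: groebner_basis_def)
      then have "y - ?s \<in> N"
        by (intro subspace_diff subspace_sum subspace_scale N yN)
      then have "y - ?s \<in> expr_le X (d - 1)"
        using Suc.IH[of "d - 1"] le k by auto
      then have "(y - ?s) + ?s \<in> expr_le X d"
        using s by (intro expr_le_add) (auto intro: expr_le_mono)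
      then show "y \<in> expr_le X d" by simp
    qed
  qed
  then show ?thesis using assms by blast
qed

section \<open>Lifts and correctness of the output\<close>

lemma lift_in_span:
  assumes "finite X" "syzygy_choice X C" "c \<in> C"
  shows "lincomb c (\<lambda>x. x) \<in> span X"
proof -
  interpret G: module "fun_scale :: 'r \<Rightarrow> ('m \<Rightarrow> 'r) \<Rightarrow> 'm \<Rightarrow> 'r" by (rule module_fun_scale)
  have "c \<in> syzygies X (initial B)"
    using assms G.span_base by (auto simp: syzygy_choice_def)
  then show ?thesis
    using sum_in_span_image[of c "\<lambda>x. x" X] assms(1) by (simp add: lincomb_eq_sum syzygies_def)
qed

lemma groebner_basis_if_stop:
  assumes X: "finite X" "0 \<notin> X" "span X = N" and stop: "buchberger_stop X"
  shows "groebner_basis X N"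
proof (rule groebner_basisI)
  show "X \<subseteq> N" using X(3) span_superset by blast
  show "0 \<notin> X" by fact
  fix y assume y: "y \<in> N" "y \<noteq> 0"
  obtain C where C: "syzygy_choice X C" and red: "\<And>z. z \<in> lifts C \<Longrightarrow> has_reduced_expression X z"
    using stop by (auto simp: buchberger_stop_def)
  have lift: "lincomb c (\<lambda>x. x) = 0 \<or> lincomb c (\<lambda>x. x) \<in> expr_le X (top_deg B (lincomb c (\<lambda>x. x)))"
    if "c \<in> C" for c
    using red[of "lincomb c (\<lambda>x. x)"] that has_reduced_expression_iff[OF X(1,2)]
    by (auto simp: lifts_def)
  have "y \<in> span X" using X(3) y(1) by simp
  then obtain d where d: "y \<in> expr_le X d" using span_in_expr_le[OF X(1)] by blast
  \<comment> \<open>Here \<open>expr_le_decrease\<close> is used with \<open>X' = X\<close>. It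
    applies as long as the bound exceeds the degree of \<open>y\<close>, so \<open>j\<close> rounds
    remove an excess of \<open>j\<close>.\<close>
  have "y \<in> expr_le X (top_deg B y + int k)" if "y \<in> expr_le X (top_deg B y + int (k + j))" for k j
    using that
  proof (induction j)
    case (Suc j)
    have "y \<in> expr_le X (top_deg B y + int (k + Suc j) - 1)"
      by (rule expr_le_decrease[OF X(1,2) C order_refl X(1) lift Suc.prems])
        (auto simp: module_grading.deg_le_iff)
    then show ?case by (intro Suc.IH) (simp add: algebra_simps)
  qed simp
  from this[of 0 "nat (d - top_deg B y)"] have "y \<in> expr_le X (top_deg B y)"
    using expr_le_mono[OF d, of "top_deg B y + nat (d - top_deg B y)"] by simp
  then show "initial B y \<in> span (initial B ` X)"
    by (rule initial_in_span_initial[OF y(2)])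
qed

section \<open>Invariants of a run and termination\<close>

lemma buchberger_step_invariant:
  assumes "buchberger_step X X'" "finite X" "0 \<notin> X" "span X = N"
  shows "X \<subseteq> X'" "finite X'" "0 \<notin> X'" "span X' = N"
proof -
  obtain C where C: "syzygy_choice X C" "X' = X \<union> (lifts C - {0})"
    using assms(1) by (auto simp: buchberger_step_def)
  show "X \<subseteq> X'" "0 \<notin> X'" using C assms by auto
  show "finite X'" using C assms by (auto simp: lifts_def syzygy_choice_def)
  have "X' \<subseteq> span X"
    using C lift_in_span[OF assms(2) C(1)] span_superset by (auto simp: lifts_def)
  then show "span X' = N"
    using \<open>X \<subseteq> X'\<close> assms(4) by (metis span_minimal span_mono subspace_span subset_antisym)
qed

lemma buchberger_steps_invariant:
  assumes "buchberger_step\<^sup>*\<^sup>* X Y" "finite X" "0 \<notin> X" "span X = N"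
  shows "finite Y \<and> 0 \<notin> Y \<and> span Y = N"
  using assms(1)
proof (induction rule: rtranclp_induct)
  case (step Y Z)
  then show ?case using buchberger_step_invariant(2-4)[OF step.hyps(2), of N] by simp
qed (use assms in simp)

text \<open>Whichever generators were chosen, each nonzero lift is itself a member of
  \<open>X'\<close> and so has a reduced expression there; \<open>expr_le_decrease\<close> then
  applies.\<close>

lemma buchberger_step_expr_le:
  assumes step: "buchberger_step X X'" and X: "finite X" "0 \<notin> X"
    and y: "y \<in> expr_le X d" "y \<in> deg_le B (d - 1)"
  shows "y \<in> expr_le X' (d - 1)"
proof -
  obtain C where C: "syzygy_choice X C" "X' = X \<union> (lifts C - {0})"
    using step by (auto simp: buchberger_step_def)
  have fin: "finite X'" using C X by (auto simp: lifts_def syzygy_choice_def)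
  show ?thesis
  proof (rule expr_le_decrease[OF X C(1) _ fin _ y])
    fix c assume "c \<in> C"
    then have "lincomb c (\<lambda>x. x) = 0 \<or> lincomb c (\<lambda>x. x) \<in> X'"
      by (auto simp: C(2) lifts_def)
    then show "lincomb c (\<lambda>x. x) = 0 \<or> lincomb c (\<lambda>x. x) \<in> expr_le X' (top_deg B (lincomb c (\<lambda>x. x)))"
      using generator_in_expr_le[OF fin] by blast
  qed (auto simp: C(2))
qed

text \<open>The run does not compute \<open>G\<close>; \<open>G\<close> only tells how long to wait.
  An expression of \<open>g\<close> whose bound exceeds the degree of \<open>g\<close> by
  \<open>j\<close> becomes reduced within \<open>j\<close> steps.\<close>

lemma no_infinite_run:
  assumes X: "finite (Y 0)" "0 \<notin> Y 0" "span (Y 0) = N"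
    and N: "subspace N" and G: "finite G" "groebner_basis G N"
    and run: "\<And>k. buchberger_step (Y k) (Y (Suc k))"
  shows False
proof -
  have inv: "finite (Y k) \<and> 0 \<notin> Y k \<and> span (Y k) = N" for k
  proof (induction k)
    case (Suc k)
    then show ?case using buchberger_step_invariant(2-4)[OF run[of k], of N] by simp
  qed (use X in simp)
  have mono: "Y i \<subseteq> Y j" if "i \<le> j" for i j
  proof (rule lift_Suc_mono_le[OF _ that])
    show "Y k \<subseteq> Y (Suc k)" for k
      using buchberger_step_invariant(1)[OF run[of k], of N] inv[of k] by simp
  qed
  have "\<exists>k. g \<in> expr_le (Y k) (top_deg B g)" if "g \<in> G" for g
  proof -
    have "g \<in> span (Y 0)" using that G(2) X(3) by (auto simp: groebner_basis_def)
    then obtain d where "g \<in> expr_le (Y 0) d" using span_in_expr_le[OF X(1)] by blast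
    then have d: "g \<in> expr_le (Y 0) (top_deg B g + int (nat (d - top_deg B g)))"
      by (rule expr_le_mono) simp
    have "\<exists>k. g \<in> expr_le (Y k) (top_deg B g)" if "g \<in> expr_le (Y i) (top_deg B g + int j)" for i j
      using that
    proof (induction j arbitrary: i)
      case 0
      then show ?case by auto
    next
      case (Suc j)
      have "g \<in> expr_le (Y (Suc i)) (top_deg B g + int (Suc j) - 1)"
        by (rule buchberger_step_expr_le[OF run _ _ Suc.prems])
          (use inv in \<open>auto simp: module_grading.deg_le_iff\<close>)
      then show ?case by (intro Suc.IH) (simp add: algebra_simps)
    qed
    then show ?thesis using d by blast
  qed
  then obtain K where K: "\<And>g. g \<in> G \<Longrightarrow> g \<in> expr_le (Y (K g)) (top_deg B g)" by metis
  \<comment> \<open>A common stage for all of \<open>G\<close>, available because \<open>G\<close>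
    is finite and the sets \<open>Y k\<close> increase; 0 covers empty \<open>G\<close>.\<close>
  define k where "k = Max (insert 0 (K ` G))"
  have Gk: "g \<in> expr_le (Y k) (top_deg B g)" if "g \<in> G" for g
  proof (rule expr_le_superset[OF K[OF that]])
    have "K g \<le> k" unfolding k_def using that G(1) by (intro Max_ge) auto
    then show "Y (K g) \<subseteq> Y k" by (rule mono)
  qed (use inv in blast)
  have "initial B g \<in> span (initial B ` Y k)" if "g \<in> G" for g
    using initial_in_span_initial[OF _ Gk[OF that]]
    by (cases "g = 0") (auto simp: initial_def span_zero)
  then have "span (initial B ` G) \<subseteq> span (initial B ` Y k)"
    by (intro span_minimal) auto
  then have sub: "span (initial B ` (N - {0})) \<subseteq> span (initial B ` Y k)"
    using G(2) by (simp add: groebner_basis_def initial_submodule_def)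
  have "groebner_basis (Y k) N"
  proof (rule groebner_basisI)
    show "Y k \<subseteq> N" using inv[of k] span_superset by blast
    show "0 \<notin> Y k" using inv by blast
    show "initial B y \<in> span (initial B ` Y k)" if "y \<in> N" "y \<noteq> 0" for y
      using that by (intro subsetD[OF sub] span_base) auto
  qed
  \<comment> \<open>Division by \<open>Y k\<close> reduces every element of \<open>N\<close>,
    including all lifts for any choice of syzygies, whereas a further step requires a lift without
    reduced expression.\<close>
  then have red: "has_reduced_expression (Y k) z" if "z \<in> N" for z
    using inv[of k] N that
    by (auto simp: has_reduced_expression_iff intro!: groebner_basis_expr_le module_grading.deg_le_top_deg)
  obtain C where C: "syzygy_choice (Y k) C" "\<not> (\<forall>z\<in>lifts C. has_reduced_expression (Y k) z)"
    using run[of k] by (auto simp: buchberger_step_def)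
  then show False
    using red lift_in_span[OF _ C(1)] inv[of k] by (auto simp: lifts_def)
qed

end

theorem proposition4p10:
  fixes scale :: "'r::comm_ring_1 \<Rightarrow> 'm::ab_group_add \<Rightarrow> 'm"
    and A :: "int \<Rightarrow> 'r set"
    and B :: "int \<Rightarrow> 'm set"
    and N :: "'m set"
    and n :: nat
    and x :: "nat \<Rightarrow> 'm"
  assumes "graded_module scale A B"
    and "\<forall>k<0. A k = {0}"
    and "graded_module.groebner_coherent scale B"
    and "module.subspace scale N"
    and "graded_module.finitely_generated scale N"
    and "\<forall>i\<in>{1..n}. x i \<noteq> 0"
    and "module.span scale (x ` {1..n}) = N"
  shows "graded_module.buchberger_terminates scale A B (x ` {1..n}) \<and>
         (\<forall>G. graded_module.buchberger_output scale A B (x ` {1..n}) G \<longrightarrow>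
              graded_module.groebner_basis scale B G N)"
proof -
  interpret graded_module scale A B by fact
  let ?X = "x ` {1..n}"
  have X: "finite ?X" "0 \<notin> ?X" "span ?X = N" using assms(6,7) by auto
  \<comment> \<open>Groebner coherence supplies the finite basis that bounds the run; graded
    coherence makes step (a) possible.\<close>
  obtain G where G: "finite G" "groebner_basis G N"
    using assms(3-5) by (auto simp: groebner_coherent_def)
  have coh: graded_coherent using assms(3) by (simp add: groebner_coherent_def)
  have "\<exists>C. syzygy_choice Y C" if "buchberger_step\<^sup>*\<^sup>* ?X Y" for Y
    using buchberger_steps_invariant[OF that X] syzygy_choice_exists[OF _ _ coh] by blast
  moreover have "\<not> (\<exists>Y. Y 0 = ?X \<and> (\<forall>k. buchberger_step (Y k) (Y (Suc k))))"
    using no_infinite_run[OF _ _ _ assms(4) G] X by metis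
  moreover have "groebner_basis Y N" if "buchberger_output ?X Y" for Y
    using that buchberger_steps_invariant[OF _ X] groebner_basis_if_stop
    unfolding buchberger_output_def by blast
  ultimately show ?thesis
    unfolding buchberger_terminates_def by blast
qed

end
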